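(* Let $\mathcal{A} = \{A_1, A_2, \ldots, A_m\}$ be linearly independent in $\mathcal{D}_n$, where $A_k = ((a_{11}^k, a_{22}^k, \ldots, a_{nn}^k))$ for each $1 \le k \le m$. Then $\mathrm{span}\{A_1, A_2, \ldots, A_m\}$ is a coproximinal subspace of $\mathcal{M}_n$ if and only if there exist exactly $m$ nonequivalent components satisfying the $*$-Property (that is, the number of equivalence classes of components satisfying the $*$-Property is exactly $m$).
   Context: $\mathcal{M}_n$ is the space of $n \times n$ real matrices with the operator norm induced by the Euclidean norm on $\mathbb{R}^n$, and $\mathcal{D}_n \subset \mathcal{M}_n$ is the subspace of diagonal matrices; $((a_{11}, \ldots, a_{nn}))$ denotes the diagonal matrix with these diagonal entries. For a subspace $\mathbb{Y}$ of a Banach space $\mathbb{X}$ and $x \in \mathbb{X}$, $y_0 \in \mathbb{Y}$ is a best coapproximation to $x$ out of $\mathbb{Y}$ if $\|y_0 - y\| \le \|x - y\|$ for all $y \in \mathbb{Y}$. The subspace $\mathbb{Y}$ is coproximinal in $\mathbb{X}$ if every element of $\mathbb{X}$ has a best coapproximation out of $\mathbb{Y}$. For $\mathcal{A}$ as in the claim and $i \in \{1, \ldots, n\}$: the $i$-th component (of $\mathcal{A}$) is the vector $(a_{ii}^1, a_{ii}^2, \ldots, a_{ii}^m) \in \mathbb{R}^m$. The $i$-th and $j$-th components are equivalent if $(a_{ii}^1, \ldots, a_{ii}^m) = \pm (a_{jj}^1, \ldots, a_{jj}^m)$, and nonequivalent otherwise. Put $P_i^+ = \{j \in \{1,\ldots,n\}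 : (a_{jj}^1, \ldots, a_{jj}^m) = (a_{ii}^1, \ldots, a_{ii}^m)\}$ and $P_i^- = \{j \in \{1,\ldots,n\} : (a_{jj}^1, \ldots, a_{jj}^m) = -(a_{ii}^1, \ldots, a_{ii}^m)\}$. The $i$-th component satisfies the $*$-Property if there exist $\beta_1, \ldots, \beta_m \in \mathbb{R}$ such that $|\sum_{k=1}^m \beta_k a_{ii}^k| > \max\{|\sum_{k=1}^m \beta_k a_{jj}^k| : 1 \le j \le n,\ j \notin P_i^+ \cup P_i^-\}$ (if no such $j$ exists, the condition is regarded as satisfied). *)

theory Defs
  imports "HOL-Analysis.Analysis"
begin

text \<open>
  The type class norm on \<open>real^'n^'n\<close> is the Frobenius norm, so the operator norm induced by
  the Euclidean norm has to be carried explicitly. For this reason coapproximation is defined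
  relative to a norm \<open>N\<close>; the ambient space is the whole type.
\<close>

definition opnorm :: "real^'n^'n \<Rightarrow> real" where
  "opnorm M = onorm (\<lambda>x. M *v x)"

definition best_coapproximation ::
    "('a::real_vector \<Rightarrow> real) \<Rightarrow> 'a set \<Rightarrow> 'a \<Rightarrow> 'a \<Rightarrow> bool" where
  "best_coapproximation N Y x y0 \<longleftrightarrow> y0 \<in> Y \<and> (\<forall>y\<in>Y. N (y0 - y) \<le> N (x - y))"

definition coproximinal :: "('a::real_vector \<Rightarrow> real) \<Rightarrow> 'a set \<Rightarrow> bool" where
  "coproximinal N Y \<longleftrightarrow> subspace Y \<and> (\<forall>x. \<exists>y0. best_coapproximation N Y x y0)"

definition diagonal_matrices :: "(real^'n^'n) set" where
  "diagonal_matrices = {D. \<forall>i j. i \<noteq> j \<longrightarrow> D $ i $ j = 0}"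

text \<open>
  A family \<open>A\<^sub>1, \<dots>, A\<^sub>m\<close> is indexed by a finite type \<open>'m\<close>, so that \<open>m = CARD('m) \<ge> 1\<close> and the
  components live in \<open>real^'m\<close>.
\<close>

definition component :: "('m::finite \<Rightarrow> real^'n^'n) \<Rightarrow> 'n \<Rightarrow> real^'m" where
  "component A i = (\<chi> k. A k $ i $ i)"

definition equivalent_components :: "('m::finite \<Rightarrow> real^'n^'n) \<Rightarrow> ('n \<times> 'n) set" where
  "equivalent_components A =
     {(i, j). component A i = component A j \<or> component A i = - component A j}"

definition P_plus :: "('m::finite \<Rightarrow> real^'n^'n) \<Rightarrow> 'n \<Rightarrow> 'n set" where
  "P_plus A i = {j. component A j = component A i}"

definition P_minus :: "('m::finite \<Rightarrow> real^'n^'n) \<Rightarrow> 'n \<Rightarrow> 'n set" where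
  "P_minus A i = {j. component A j = - component A i}"

text \<open>\<open>Max {}\<close> is unspecified, hence the separate disjunct for the case that no \<open>j\<close> is left.\<close>

definition star_property :: "('m::finite \<Rightarrow> real^'n^'n) \<Rightarrow> 'n::finite \<Rightarrow> bool" where
  "star_property A i \<longleftrightarrow>
     {j. j \<notin> P_plus A i \<union> P_minus A i} = {} \<or>
     (\<exists>\<beta> :: 'm \<Rightarrow> real.
        \<bar>\<Sum>k\<in>UNIV. \<beta> k * A k $ i $ i\<bar>
          > Max {\<bar>\<Sum>k\<in>UNIV. \<beta> k * A k $ j $ j\<bar> | j. j \<notin> P_plus A i \<union> P_minus A i})"

end

theory Submission
  imports Defs
begin

text \<open>
  Write \<open>c\<^sub>i\<close> for the \<open>i\<close>-th component. The coefficient vector \<open>\<beta>\<close> of a matrix in the span gives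
  the diagonal entries \<open>\<beta> \<bullet> c\<^sub>i\<close>, and the operator norm of that matrix is the largest
  \<open>\<bar>\<beta> \<bullet> c\<^sub>i\<bar>\<close>. So the dual unit ball of the span is the polytope \<open>K = conv {\<plusminus> c\<^sub>i}\<close>, and the
  \<open>*\<close>-Property says that \<open>c\<^sub>i\<close> is an exposed point of \<open>K\<close>, that is, a vertex. Choose one index
  from each equivalence class of components with the \<open>*\<close>-Property and let \<open>R\<close> be the set of
  these indices. By the Krein-Milman theorem \<open>K\<close> is the convex hull of its vertices
  \<open>\<plusminus> c\<^sub>r\<close>, \<open>r \<in> R\<close>. Linear independence of the matrices makes the components span the
  \<open>m\<close>-dimensional coefficient space, so the \<open>c\<^sub>r\<close> span it too, and \<open>R\<close> has exactly \<open>m\<close>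
  elements iff the \<open>c\<^sub>r\<close> are linearly independent. It remains to compare this independence with
  coproximinality.

  If the \<open>c\<^sub>r\<close> are independent, every matrix \<open>T\<close> has a \<open>y\<^sub>0\<close> in the span that agrees with \<open>T\<close> at
  the diagonal positions in \<open>R\<close>. The norm on the span is the maximum over the positions in \<open>R\<close>,
  and a diagonal entry never exceeds the operator norm; hence \<open>y\<^sub>0\<close> is a best coapproximation
  (\<open>independent_imp_coproximinal\<close>).

  Conversely, let \<open>T\<close> be diagonal and compatible with the symmetries of the components:
  \<open>T\<^sub>j\<^sub>j = \<plusminus> T\<^sub>i\<^sub>i\<close> when \<open>c\<^sub>j = \<plusminus> c\<^sub>i\<close>. If \<open>c\<^sub>i\<close> is a vertex, exposed by the
  functional \<open>a\<close>, then far out along the ray through \<open>a\<close>, and also along the opposite ray, the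
  distance to \<open>T\<close> is attained at position \<open>i\<close>. The inequalities of coapproximation then pin
  down the \<open>i\<close>-th entry of \<open>y\<^sub>0\<close> to be \<open>T\<^sub>i\<^sub>i\<close> (\<open>best_coapproximation_diagonal_entry\<close>).
  Taking for \<open>T\<close> the indicator of a single class yields functionals dual to the \<open>c\<^sub>r\<close>, so the
  \<open>c\<^sub>r\<close> are independent (\<open>coproximinal_imp_independent\<close>).
\<close>

section \<open>Vertices of the symmetric polytope spanned by a finite family\<close>

text \<open>
  The vector \<open>c i\<close> is an exposed point of the convex hull of all \<open>\<plusminus> c j\<close>, with exposing
  functional \<open>a\<close>. Positivity excludes the zero vector, which would otherwise
  qualify when all members of the family vanish.
\<close>

definition vertex_member :: "('i \<Rightarrow> 'a::real_inner) \<Rightarrow> 'i \<Rightarrow> bool" where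
  "vertex_member c i \<longleftrightarrow>
     (\<exists>a. 0 < a \<bullet> c i \<and> (\<forall>j. c j \<noteq> c i \<longrightarrow> c j \<noteq> - c i \<longrightarrow> \<bar>a \<bullet> c j\<bar> < a \<bullet> c i))"

lemma self_eq_minus_iff: "x = - x \<longleftrightarrow> x = 0" for x :: "'a::real_vector"
  by (metis add_eq_0_iff scaleR_2 scaleR_eq_0_iff zero_neq_numeral)

text \<open>
  An extreme point of a polytope is one of the generators, and as a face of a polyhedron it is
  exposed. By symmetry of the generating set, a functional that exposes \<open>x\<close> bounds
  the absolute value at all generators, strictly so away from \<open>\<plusminus> x\<close>.
\<close>

lemma extreme_point_obtains_vertex_member:
  fixes c :: "'i::finite \<Rightarrow> 'a::euclidean_space"
  assumes nz: "\<exists>i. c i \<noteq> 0"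
    and x: "x extreme_point_of convex hull (range c \<union> uminus ` range c)"
  obtains i where "vertex_member c i" "x = c i \<or> x = - c i"
proof -
  define S where "S = range c \<union> uminus ` range c"
  have S_uminus: "- y \<in> S" if "y \<in> S" for y
    using that by (auto simp: S_def)
  have "polytope (convex hull S)"
    by (rule polytope_convex_hull) (simp add: S_def)
  then have "{x} exposed_face_of convex hull S"
    using x by (simp add: S_def exposed_face_of_polyhedron polytope_imp_polyhedron face_of_singleton)
  then obtain a b where le: "convex hull S \<subseteq> {y. a \<bullet> y \<le> b}"
    and eq: "{x} = convex hull S \<inter> {y. a \<bullet> y = b}"
    by (auto simp: exposed_face_of_def)
  have xS: "x \<in> S"
    using x extreme_point_of_convex_hull by (auto simp: S_def)
  have S_le: "a \<bullet> y \<le> b" if "y \<in> S" for y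
    using that le hull_subset[of S convex] by auto
  have S_less: "\<bar>a \<bullet> y\<bar> < b" if "y \<in> S" "y \<noteq> x" "y \<noteq> - x" for y
  proof -
    have "y \<notin> {x}" "- y \<notin> {x}"
      using that by auto
    then have "a \<bullet> y \<noteq> b" "a \<bullet> (- y) \<noteq> b"
      unfolding eq using hull_inc[OF \<open>y \<in> S\<close>, of convex] hull_inc[OF S_uminus[OF \<open>y \<in> S\<close>], of convex]
      by blast+
    with S_le[OF \<open>y \<in> S\<close>] S_le[OF S_uminus[OF \<open>y \<in> S\<close>]] show ?thesis
      by simp
  qed
  have ax: "a \<bullet> x = b"
    using eq by auto
  have "b > 0"
  proof (rule ccontr)
    assume "\<not> b > 0"
    obtain i where "c i \<noteq> 0"
      using nz by blast
    have ci: "c i \<in> S" "- c i \<in> S"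
      by (simp_all add: S_def)
    \<comment> \<open>If \<open>b \<le> 0\<close>, symmetry forces the functional to be constant on the polytope, so that the
      exposed face contains both \<open>c i\<close> and \<open>- c i\<close> and is not a single point.\<close>
    have "a \<bullet> c i = b" "a \<bullet> (- c i) = b"
      using S_le[OF ci(1)] S_le[OF ci(2)] \<open>\<not> b > 0\<close> by auto
    then have "c i \<in> {x}" "- c i \<in> {x}"
      unfolding eq using hull_inc[OF ci(1), of convex] hull_inc[OF ci(2), of convex] by blast+
    then have "c i = - c i"
      by auto
    with \<open>c i \<noteq> 0\<close> show False
      by (simp add: self_eq_minus_iff)
  qed
  obtain i where i: "x = c i \<or> x = - c i"
    using xS by (auto simp: S_def)
  obtain s :: real where s: "s = 1 \<or> s = -1" "x = s *\<^sub>R c i"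
    using i by (metis scaleR_minus1_left scaleR_one)
  have "vertex_member c i"
    unfolding vertex_member_def
  proof (intro exI[of _ "s *\<^sub>R a"] conjI allI impI)
    have val: "(s *\<^sub>R a) \<bullet> c i = b"
      using ax s by auto
    show "0 < (s *\<^sub>R a) \<bullet> c i"
      using val \<open>b > 0\<close> by simp
    fix j assume "c j \<noteq> c i" "c j \<noteq> - c i"
    then have "\<bar>a \<bullet> c j\<bar> < b"
      using s by (intro S_less) (auto simp: S_def)
    then show "\<bar>(s *\<^sub>R a) \<bullet> c j\<bar> < (s *\<^sub>R a) \<bullet> c i"
      unfolding val using s(1) by auto
  qed
  with i that show thesis
    by blast
qed

text \<open>
  The form in which the Krein-Milman theorem is used: with \<open>C\<close> a subspace it shows that the vertices
  span, with \<open>C\<close> a slab that they determine the norm.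
\<close>

lemma in_symmetric_convex_if_vertex_members_in:
  fixes c :: "'i::finite \<Rightarrow> 'a::euclidean_space"
  assumes nz: "\<exists>i. c i \<noteq> 0"
    and C: "convex C" "\<And>x. x \<in> C \<Longrightarrow> - x \<in> C"
    and vert: "\<And>i. vertex_member c i \<Longrightarrow> c i \<in> C"
  shows "c j \<in> C"
proof -
  let ?K = "convex hull (range c \<union> uminus ` range c)"
  have "compact ?K"
    by (simp add: finite_imp_compact_convex_hull)
  then have "?K = convex hull {x. x extreme_point_of ?K}"
    by (rule Krein_Milman_Minkowski) (rule convex_convex_hull)
  moreover have "{x. x extreme_point_of ?K} \<subseteq> C"
    using extreme_point_obtains_vertex_member[OF nz] vert C(2) by (metis mem_Collect_eq subsetI)
  ultimately have "?K \<subseteq> C"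
    using C(1) by (metis hull_minimal)
  then show ?thesis
    using hull_subset[of "range c \<union> uminus ` range c" convex] by auto
qed

lemma span_vertex_representatives:
  fixes c :: "'i::finite \<Rightarrow> 'a::euclidean_space"
  assumes span_c: "span (range c) = UNIV"
    and nz: "\<exists>i. c i \<noteq> 0"
    and rep: "\<And>i. vertex_member c i \<Longrightarrow> \<exists>r\<in>R. c i = c r \<or> c i = - c r"
  shows "span (c ` R) = UNIV"
proof -
  have "c j \<in> span (c ` R)" for j
  proof (rule in_symmetric_convex_if_vertex_members_in[OF nz])
    show "convex (span (c ` R))"
      by (simp add: subspace_imp_convex)
    show "- x \<in> span (c ` R)" if "x \<in> span (c ` R)" for x
      using that by (rule span_neg)
    show "c i \<in> span (c ` R)" if "vertex_member c i" for i
      using rep[OF that] by (metis imageI span_base span_neg)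
  qed
  then have "span (range c) \<subseteq> span (c ` R)"
    by (intro span_minimal) auto
  with span_c show ?thesis
    by auto
qed

section \<open>Linear independence and functionals with prescribed values\<close>

lemma independent_image_if_dual_family:
  fixes c :: "'i \<Rightarrow> 'a::real_inner"
  assumes "\<And>r. r \<in> R \<Longrightarrow> \<exists>g. g \<bullet> c r \<noteq> 0 \<and> (\<forall>s\<in>R. s \<noteq> r \<longrightarrow> g \<bullet> c s = 0)"
  shows "independent (c ` R)"
proof
  assume "dependent (c ` R)"
  then obtain r where r: "r \<in> R" "c r \<in> span (c ` R - {c r})"
    by (auto simp: dependent_def)
  obtain g where g: "g \<bullet> c r \<noteq> 0" "\<And>s. s \<in> R \<Longrightarrow> s \<noteq> r \<Longrightarrow> g \<bullet> c s = 0"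
    using assms[OF r(1)] by auto
  have "span (c ` R - {c r}) \<subseteq> {x. g \<bullet> x = 0}"
    using g(2) by (intro span_minimal subspace_hyperplane) blast
  with r(2) g(1) show False
    by auto
qed

lemma independent_obtains_interpolation:
  fixes c :: "'i \<Rightarrow> 'a::euclidean_space"
  assumes "independent (c ` R)" "inj_on c R"
  obtains g where "\<And>r. r \<in> R \<Longrightarrow> g \<bullet> c r = \<tau> r"
proof -
  obtain f :: "'a \<Rightarrow> real" where f: "linear f" "\<And>x. x \<in> c ` R \<Longrightarrow> f x = \<tau> (inv_into R c x)"
    using linear_independent_extend[OF assms(1), of "\<lambda>x. \<tau> (inv_into R c x)"] by blast
  have "adjoint f 1 \<bullet> c r = \<tau> r" if "r \<in> R" for r
    using adjoint_works[OF f(1), of "c r" 1] f(2)[of "c r"] that assms(2)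
    by (simp add: inner_commute)
  with that show thesis
    by blast
qed

section \<open>Diagonal matrices and the operator norm\<close>

definition lincomb :: "('m::finite \<Rightarrow> real^'n^'n) \<Rightarrow> real^'m \<Rightarrow> real^'n^'n" where
  "lincomb A \<beta> = (\<Sum>k\<in>UNIV. \<beta> $ k *\<^sub>R A k)"

lemma linear_lincomb: "linear (lincomb A)"
  by (rule linearI) (simp_all add: lincomb_def scaleR_add_left sum.distrib scaleR_sum_right)

lemma span_range_eq_range_lincomb: "span (range A) = range (lincomb A)"
proof
  have "lincomb A (axis k 1) = A k" for k
    by (simp add: lincomb_def axis_def if_distrib[of "\<lambda>x. x *\<^sub>R _"] cong: if_cong)
  then have "range A \<subseteq> range (lincomb A)"
    by (metis image_subsetI rangeI)
  then show "span (range A) \<subseteq> range (lincomb A)"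
    by (rule span_minimal) (simp add: linear_subspace_image linear_lincomb)
  show "range (lincomb A) \<subseteq> span (range A)"
    by (auto simp: lincomb_def intro!: span_sum span_mul intro: span_base)
qed

lemma lincomb_diagonal_entry: "lincomb A \<beta> $ i $ i = \<beta> \<bullet> component A i"
  by (simp add: lincomb_def component_def inner_vec_def)

lemma lincomb_diagonal:
  assumes "\<And>k. A k \<in> diagonal_matrices"
  shows "lincomb A \<beta> \<in> diagonal_matrices"
  using assms by (auto simp: lincomb_def diagonal_matrices_def)

lemma diagonal_matrices_diff:
  "D \<in> diagonal_matrices \<Longrightarrow> E \<in> diagonal_matrices \<Longrightarrow> D - E \<in> diagonal_matrices"
  by (auto simp: diagonal_matrices_def)

lemma abs_diagonal_entry_le_opnorm: "\<bar>M $ i $ i\<bar> \<le> opnorm M"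
  unfolding opnorm_def by (rule matrix_component_le_onorm)

lemma opnorm_diagonal_le:
  fixes D :: "real^'n^'n"
  assumes D: "D \<in> diagonal_matrices" and b: "\<And>i. \<bar>D $ i $ i\<bar> \<le> b"
  shows "opnorm D \<le> b"
  unfolding opnorm_def
proof (rule onorm_le)
  fix x :: "real^'n"
  have "b \<ge> 0"
    using b[of undefined] by linarith
  have "(D *v x) $ i = D $ i $ i * x $ i" for i
  proof -
    have "(\<Sum>j\<in>UNIV. D $ i $ j * x $ j) = (\<Sum>j\<in>UNIV. if j = i then D $ i $ j * x $ j else 0)"
      using D by (intro sum.cong) (auto simp: diagonal_matrices_def)
    then show ?thesis
      by (simp add: matrix_vector_mult_def)
  qed
  then have "norm (D *v x) \<le> norm (b *\<^sub>R x)"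
    using b \<open>b \<ge> 0\<close> by (intro norm_le_componentwise_cart) (simp add: abs_mult mult_right_mono)
  then show "norm (D *v x) \<le> b * norm x"
    using \<open>b \<ge> 0\<close> by simp
qed

text \<open>
  A vector \<open>\<beta>\<close> orthogonal to all components is the coefficient vector of a vanishing linear
  combination of the matrices.
\<close>

lemma span_components:
  fixes A :: "'m::finite \<Rightarrow> real^'n^'n"
  assumes diag: "\<And>k. A k \<in> diagonal_matrices"
    and lin_indep: "inj A" "independent (range A)"
  shows "span (range (component A)) = UNIV"
proof (rule ccontr)
  assume "span (range (component A)) \<noteq> UNIV"
  then obtain \<beta> where \<beta>: "\<beta> \<noteq> 0" "\<And>i. \<beta> \<bullet> component A i = 0"
    using span_not_UNIV_orthogonal by (metis rangeI span_base)
  have "lincomb A \<beta> = 0"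
    unfolding vec_eq_iff
    using lincomb_diagonal[of A \<beta>, OF diag] lincomb_diagonal_entry[of A \<beta>] \<beta>(2)
    by (metis (mono_tags, lifting) diagonal_matrices_def mem_Collect_eq zero_index)
  then have "(\<Sum>v\<in>range A. \<beta> $ inv A v *\<^sub>R v) = 0"
    using lin_indep(1) by (simp add: sum.reindex lincomb_def)
  then have "\<beta> $ k = 0" for k
    using independentD[OF lin_indep(2), of "range A" "\<lambda>v. \<beta> $ inv A v" "A k"] lin_indep(1)
    by simp
  with \<beta>(1) show False
    by (simp add: vec_eq_iff)
qed

section \<open>The star property characterizes vertices\<close>

text \<open>
  If some component is nonzero, the two degenerate situations agree: when every component is
  equivalent to the \<open>i\<close>-th one, the \<open>i\<close>-th one is nonzero and exposes itself.
\<close>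

lemma star_property_iff_vertex_member:
  fixes A :: "'m::finite \<Rightarrow> real^'n^'n"
  assumes nz: "\<exists>i. component A i \<noteq> 0"
  shows "star_property A i \<longleftrightarrow> vertex_member (component A) i"
proof -
  let ?c = "component A"
  let ?J = "{j. j \<notin> P_plus A i \<union> P_minus A i}"
  have J: "j \<in> ?J \<longleftrightarrow> ?c j \<noteq> ?c i \<and> ?c j \<noteq> - ?c i" for j
    by (auto simp: P_plus_def P_minus_def)
  have sum_eq: "(\<Sum>k\<in>UNIV. \<beta> k * A k $ j $ j) = (\<chi> k. \<beta> k) \<bullet> ?c j" for \<beta> j
    by (simp add: component_def inner_vec_def)
  have star_iff: "star_property A i \<longleftrightarrow>
      ?J = {} \<or> (\<exists>a. Max ((\<lambda>j. \<bar>a \<bullet> ?c j\<bar>) ` ?J) < \<bar>a \<bullet> ?c i\<bar>)"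
  proof -
    have "(\<exists>\<beta>. P (\<chi> k. \<beta> k)) \<longleftrightarrow> (\<exists>a. P a)" for P :: "real^'m \<Rightarrow> bool"
      by (metis vec_nth_inverse)
    from this[of "\<lambda>a. Max ((\<lambda>j. \<bar>a \<bullet> ?c j\<bar>) ` ?J) < \<bar>a \<bullet> ?c i\<bar>"] show ?thesis
      unfolding star_property_def sum_eq setcompr_eq_image[symmetric] by simp
  qed
  show ?thesis
  proof
    assume star: "star_property A i"
    show "vertex_member ?c i"
    proof (cases "?J = {}")
      case True
      then have "?c i \<noteq> 0"
        using nz J by (metis empty_iff neg_equal_0_iff_equal)
      with True J show ?thesis
        unfolding vertex_member_def by (intro exI[of _ "?c i"]) auto
    next
      case False
      with star obtain a where "Max ((\<lambda>j. \<bar>a \<bullet> ?c j\<bar>) ` ?J) < \<bar>a \<bullet> ?c i\<bar>"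
        by (auto simp: star_iff)
      then have less: "\<bar>a \<bullet> ?c j\<bar> < \<bar>a \<bullet> ?c i\<bar>" if "j \<in> ?J" for j
        using that False by (subst (asm) Max_less_iff) auto
      then have "a \<bullet> ?c i \<noteq> 0"
        using False by fastforce
      then consider "0 < a \<bullet> ?c i" | "0 < - a \<bullet> ?c i"
        by fastforce
      then show ?thesis
      proof cases
        case 1
        with less J show ?thesis
          unfolding vertex_member_def by (intro exI[of _ a]) simp
      next
        case 2
        with less J show ?thesis
          unfolding vertex_member_def by (intro exI[of _ "- a"]) simp
      qed
    qed
  next
    assume "vertex_member ?c i"
    then obtain a where "0 < a \<bullet> ?c i" "\<And>j. j \<in> ?J \<Longrightarrow> \<bar>a \<bullet> ?c j\<bar> < a \<bullet> ?c i"
      unfolding vertex_member_def J by blast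
    then show "star_property A i"
      unfolding star_iff disj_imp by (intro impI exI[of _ a]) (subst Max_less_iff, auto)
  qed
qed

section \<open>Coproximinality implies independence of the vertices\<close>

lemma eventually_le_mult_at_top:
  fixes e :: real
  assumes "e > 0"
  shows "eventually (\<lambda>t. d \<le> t * e) at_top"
  using eventually_ge_at_top[of "d / e"] by eventually_elim (use assms in \<open>simp add: field_simps\<close>)

text \<open>
  Compare \<open>T\<close> and \<open>y0\<close> with \<open>\<plusminus> t a\<close>, where \<open>a\<close> exposes the vertex \<open>i\<close> and \<open>t\<close> is large. Every
  position not equivalent to \<open>i\<close> lags behind by a multiple of \<open>t\<close>, so the distance from \<open>T\<close> is at
  most \<open>t (a \<bullet> c\<^sub>i) \<mp> T\<^sub>i\<^sub>i\<close>; the distance from \<open>y0\<close> is at least the \<open>i\<close>-th entry of the difference. The two signs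
  give the two inequalities.
\<close>

lemma best_coapproximation_diagonal_entry:
  fixes A :: "'m::finite \<Rightarrow> real^'n^'n"
  assumes diag: "\<And>k. A k \<in> diagonal_matrices"
    and T: "T \<in> diagonal_matrices"
    and best: "best_coapproximation opnorm (span (range A)) T y0"
    and vert: "vertex_member (component A) i"
    and plus: "\<And>j. component A j = component A i \<Longrightarrow> T $ j $ j = T $ i $ i"
    and minus: "\<And>j. component A j = - component A i \<Longrightarrow> T $ j $ j = - T $ i $ i"
  shows "y0 $ i $ i = T $ i $ i"
proof -
  let ?c = "component A"
  obtain a where a: "0 < a \<bullet> ?c i"
      "\<And>j. ?c j \<noteq> ?c i \<Longrightarrow> ?c j \<noteq> - ?c i \<Longrightarrow> \<bar>a \<bullet> ?c j\<bar> < a \<bullet> ?c i"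
    using vert by (auto simp: vertex_member_def)
  have "eventually (\<lambda>t. \<bar>T $ j $ j\<bar> + \<bar>T $ i $ i\<bar> \<le> t * (a \<bullet> ?c i - \<bar>a \<bullet> ?c j\<bar>)) at_top"
    if "?c j \<noteq> ?c i" "?c j \<noteq> - ?c i" for j
    using a(2)[OF that] by (intro eventually_le_mult_at_top) simp
  then have "eventually (\<lambda>t. \<forall>j. ?c j \<noteq> ?c i \<longrightarrow> ?c j \<noteq> - ?c i \<longrightarrow>
      \<bar>T $ j $ j\<bar> + \<bar>T $ i $ i\<bar> \<le> t * (a \<bullet> ?c i - \<bar>a \<bullet> ?c j\<bar>)) at_top"
    by (intro eventually_all_finite) simp
  moreover have "eventually (\<lambda>t. \<bar>T $ i $ i\<bar> \<le> t * (a \<bullet> ?c i)) at_top"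
    by (rule eventually_le_mult_at_top[OF a(1)])
  ultimately have "eventually (\<lambda>t. 0 \<le> t \<and> \<bar>T $ i $ i\<bar> \<le> t * (a \<bullet> ?c i) \<and>
      (\<forall>j. ?c j \<noteq> ?c i \<longrightarrow> ?c j \<noteq> - ?c i \<longrightarrow>
        \<bar>T $ j $ j\<bar> + \<bar>T $ i $ i\<bar> \<le> t * (a \<bullet> ?c i - \<bar>a \<bullet> ?c j\<bar>))) at_top"
    using eventually_ge_at_top[of 0] by eventually_elim blast
  then obtain t where t: "0 \<le> t" "\<bar>T $ i $ i\<bar> \<le> t * (a \<bullet> ?c i)"
      "\<And>j. ?c j \<noteq> ?c i \<Longrightarrow> ?c j \<noteq> - ?c i \<Longrightarrow>
        \<bar>T $ j $ j\<bar> + \<bar>T $ i $ i\<bar> \<le> t * (a \<bullet> ?c i - \<bar>a \<bullet> ?c j\<bar>)"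
    by (auto dest!: eventually_happens)
  have bound: "\<sigma> * T $ i $ i \<le> \<sigma> * y0 $ i $ i" if \<sigma>: "\<sigma> = 1 \<or> \<sigma> = -1" for \<sigma> :: real
  proof -
    let ?y = "lincomb A ((\<sigma> * t) *\<^sub>R a)"
    have y: "?y $ j $ j = \<sigma> * (t * (a \<bullet> ?c j))" for j
      by (simp add: lincomb_diagonal_entry)
    have "opnorm (T - ?y) \<le> t * (a \<bullet> ?c i) - \<sigma> * T $ i $ i"
    proof (rule opnorm_diagonal_le)
      show "T - ?y \<in> diagonal_matrices"
        by (intro diagonal_matrices_diff T lincomb_diagonal diag)
      fix j
      consider "?c j = ?c i" | "?c j = - ?c i" | "?c j \<noteq> ?c i" "?c j \<noteq> - ?c i"
        by blast
      then show "\<bar>(T - ?y) $ j $ j\<bar> \<le> t * (a \<bullet> ?c i) - \<sigma> * T $ i $ i"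
      proof cases
        case 1
        with plus[OF 1] t(2) \<sigma> show ?thesis
          by (auto simp: y)
      next
        case 2
        with minus[OF 2] t(2) \<sigma> show ?thesis
          by (auto simp: y)
      next
        case 3
        have "\<bar>t * (a \<bullet> ?c j)\<bar> = t * \<bar>a \<bullet> ?c j\<bar>"
          using t(1) by (simp add: abs_mult)
        with t(3)[OF 3] \<sigma> show ?thesis
          by (auto simp: y right_diff_distrib)
      qed
    qed
    moreover have "opnorm (y0 - ?y) \<le> opnorm (T - ?y)"
      using best by (auto simp: best_coapproximation_def span_range_eq_range_lincomb)
    moreover have "\<bar>(y0 - ?y) $ i $ i\<bar> \<le> opnorm (y0 - ?y)"
      by (rule abs_diagonal_entry_le_opnorm)
    ultimately show ?thesis
      using \<sigma> by (auto simp: y)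
  qed
  from bound[of 1] bound[of "-1"] show ?thesis
    by simp
qed

text \<open>
  For each \<open>r\<close>, the coefficients of a best coapproximation to the signed indicator of the class of
  \<open>r\<close> form a functional that is \<open>1\<close> at the vertex \<open>r\<close> and \<open>0\<close> at the other representatives.
\<close>

lemma coproximinal_imp_independent:
  fixes A :: "'m::finite \<Rightarrow> real^'n^'n"
  assumes diag: "\<And>k. A k \<in> diagonal_matrices"
    and coprox: "coproximinal opnorm (span (range A))"
    and vert: "\<And>r. r \<in> R \<Longrightarrow> vertex_member (component A) r"
    and inequiv: "\<And>r s. r \<in> R \<Longrightarrow> s \<in> R \<Longrightarrow>
      component A r = component A s \<or> component A r = - component A s \<Longrightarrow> r = s"
  shows "independent (component A ` R)"
proof (rule independent_image_if_dual_family)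
  let ?c = "component A"
  fix r assume r: "r \<in> R"
  \<comment> \<open>The signs in the indicator below are consistent because the vertex \<open>r\<close> is nonzero.\<close>
  have "?c r \<noteq> - ?c r"
  proof
    assume "?c r = - ?c r"
    moreover have "?c r \<noteq> 0"
      using vert[OF r] by (auto simp: vertex_member_def)
    ultimately show False
      by (simp add: self_eq_minus_iff)
  qed
  define T :: "real^'n^'n" where
    "T = (\<chi> i j. if i \<noteq> j then 0 else if ?c i = ?c r then 1 else if ?c i = - ?c r then -1 else 0)"
  have T: "T \<in> diagonal_matrices"
    by (simp add: T_def diagonal_matrices_def)
  obtain y0 where y0: "best_coapproximation opnorm (span (range A)) T y0"
    using coprox by (auto simp: coproximinal_def)
  then obtain g where g: "y0 = lincomb A g"
    by (auto simp: best_coapproximation_def span_range_eq_range_lincomb)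
  have "g \<bullet> ?c s = T $ s $ s" if s: "s \<in> R" for s
  proof -
    have "y0 $ s $ s = T $ s $ s"
    proof (rule best_coapproximation_diagonal_entry[OF diag T y0 vert[OF s]])
      fix j
      show "T $ j $ j = T $ s $ s" if "?c j = ?c s"
        using that by (simp add: T_def)
      show "T $ j $ j = - T $ s $ s" if "?c j = - ?c s"
        using that \<open>?c r \<noteq> - ?c r\<close> by (auto simp: T_def minus_equation_iff[of "?c s"])
    qed
    then show ?thesis
      by (simp add: g lincomb_diagonal_entry)
  qed
  moreover have "T $ s $ s = 0" if "s \<in> R" "s \<noteq> r" for s
    using inequiv[of s r] that r by (auto simp: T_def)
  moreover have "T $ r $ r = 1"
    by (simp add: T_def)
  ultimately show "\<exists>g. g \<bullet> ?c r \<noteq> 0 \<and> (\<forall>s\<in>R. s \<noteq> r \<longrightarrow> g \<bullet> ?c s = 0)"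
    using r by (intro exI[of _ g]) auto
qed

section \<open>Independence of the vertices implies coproximinality\<close>

text \<open>
  Interpolating the diagonal entries of \<open>T\<close> at the positions in \<open>R\<close> gives a best coapproximation:
  there the difference to an element of the span is bounded by the norm of the corresponding
  difference for \<open>T\<close>, and a bound at the vertices extends to all components because the slab
  \<open>{x. \<bar>(g - \<beta>) \<bullet> x\<bar> \<le> b}\<close> is convex and symmetric.
\<close>

lemma independent_imp_coproximinal:
  fixes A :: "'m::finite \<Rightarrow> real^'n^'n"
  assumes diag: "\<And>k. A k \<in> diagonal_matrices"
    and nz: "\<exists>i. component A i \<noteq> 0"
    and rep: "\<And>i. vertex_member (component A) i \<Longrightarrow>
      \<exists>r\<in>R. component A i = component A r \<or> component A i = - component A r"
    and inj: "inj_on (component A) R"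
    and indep: "independent (component A ` R)"
  shows "coproximinal opnorm (span (range A))"
  unfolding coproximinal_def
proof (intro conjI allI)
  let ?c = "component A"
  fix T :: "real^'n^'n"
  obtain g where g: "\<And>r. r \<in> R \<Longrightarrow> g \<bullet> ?c r = T $ r $ r"
    using independent_obtains_interpolation[OF indep inj, of "\<lambda>r. T $ r $ r"] by blast
  have "opnorm (lincomb A g - lincomb A \<beta>) \<le> opnorm (T - lincomb A \<beta>)" (is "_ \<le> ?b") for \<beta>
  proof (rule opnorm_diagonal_le)
    show "lincomb A g - lincomb A \<beta> \<in> diagonal_matrices"
      by (intro diagonal_matrices_diff lincomb_diagonal diag)
    fix j
    have "?c j \<in> {x. (g - \<beta>) \<bullet> x \<le> ?b} \<inter> {x. - ?b \<le> (g - \<beta>) \<bullet> x}"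
    proof (rule in_symmetric_convex_if_vertex_members_in[OF nz])
      show "convex ({x. (g - \<beta>) \<bullet> x \<le> ?b} \<inter> {x. - ?b \<le> (g - \<beta>) \<bullet> x})"
        using convex_halfspace_le convex_halfspace_ge[of "- ?b" "g - \<beta>"] by (intro convex_Int) auto
      fix i assume "vertex_member ?c i"
      then obtain r where r: "r \<in> R" "?c i = ?c r \<or> ?c i = - ?c r"
        using rep by blast
      have "\<bar>(g - \<beta>) \<bullet> ?c r\<bar> \<le> ?b"
        using abs_diagonal_entry_le_opnorm[of "T - lincomb A \<beta>" r]
        by (simp add: lincomb_diagonal_entry inner_diff_left g[OF r(1)])
      with r(2) show "?c i \<in> {x. (g - \<beta>) \<bullet> x \<le> ?b} \<inter> {x. - ?b \<le> (g - \<beta>) \<bullet> x}"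
        by auto
    qed auto
    then show "\<bar>(lincomb A g - lincomb A \<beta>) $ j $ j\<bar> \<le> ?b"
      by (auto simp: lincomb_diagonal_entry inner_diff_left)
  qed
  then show "\<exists>y0. best_coapproximation opnorm (span (range A)) T y0"
    by (intro exI[of _ "lincomb A g"])
      (auto simp: best_coapproximation_def span_range_eq_range_lincomb)
qed simp

section \<open>Counting equivalence classes\<close>

lemma quotient_obtains_representatives:
  obtains R where "R \<subseteq> S" "inj_on (\<lambda>x. E `` {x}) R" "S // E = (\<lambda>x. E `` {x}) ` R"
proof -
  have "S // E \<subseteq> (\<lambda>x. E `` {x}) ` S"
    unfolding quotient_def by blast
  then have "\<exists>R. R \<subseteq> S \<and> inj_on (\<lambda>x. E `` {x}) R \<and> S // E = (\<lambda>x. E `` {x}) ` R"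
    by (simp only: subset_image_inj)
  then show thesis
    by (elim exE conjE) (rule that)
qed

theorem theorem2p15:
  fixes A :: "'m::finite \<Rightarrow> real^'n^'n"
  assumes diag: "\<And>k. A k \<in> diagonal_matrices"
    and lin_indep: "inj A" "independent (range A)"
  shows "coproximinal opnorm (span (range A)) \<longleftrightarrow>
    card ({i. star_property A i} // equivalent_components A) = CARD('m)"
proof -
  let ?c = "component A" and ?E = "equivalent_components A"
  have span_c: "span (range ?c) = UNIV"
    using span_components[OF diag lin_indep] .
  have nz: "\<exists>i. ?c i \<noteq> 0"
  proof (rule ccontr)
    assume "\<not> ?thesis"
    then have "span (range ?c) \<subseteq> {0}"
      by (intro span_minimal) auto
    then have "axis undefined (1::real) = (0 :: real^'m)"
      using span_c by blast
    then show False
      by (simp add: axis_eq_0_iff)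
  qed
  obtain R where R: "R \<subseteq> {i. star_property A i}" "inj_on (\<lambda>i. ?E `` {i}) R"
      "{i. star_property A i} // ?E = (\<lambda>i. ?E `` {i}) ` R"
    using quotient_obtains_representatives by blast
  have class_eq_iff: "?E `` {i} = ?E `` {j} \<longleftrightarrow> ?c i = ?c j \<or> ?c i = - ?c j" for i j
    by (auto simp: equivalent_components_def set_eq_iff)
  have vert: "vertex_member ?c r" if "r \<in> R" for r
    using R(1) that star_property_iff_vertex_member[OF nz] by auto
  have rep: "\<exists>r\<in>R. ?c i = ?c r \<or> ?c i = - ?c r" if "vertex_member ?c i" for i
  proof -
    have "?E `` {i} \<in> {i. star_property A i} // ?E"
      using that star_property_iff_vertex_member[OF nz] by (intro quotientI) simp
    then show ?thesis
      unfolding R(3) image_iff class_eq_iff .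
  qed
  have inequiv: "r = s" if "r \<in> R" "s \<in> R" "?c r = ?c s \<or> ?c r = - ?c s" for r s
    using inj_onD[OF R(2) _ that(1,2)] that(3) by (simp add: class_eq_iff)
  then have inj: "inj_on ?c R"
    by (auto intro: inj_onI)
  have card_R: "card ({i. star_property A i} // ?E) = card (?c ` R)"
    by (simp add: R(3) card_image[OF R(2)] card_image[OF inj])
  have span_R: "span (?c ` R) = UNIV"
    by (rule span_vertex_representatives[OF span_c nz rep])
  have "coproximinal opnorm (span (range A)) \<longleftrightarrow> independent (?c ` R)"
    using coproximinal_imp_independent[OF diag _ vert inequiv]
      independent_imp_coproximinal[OF diag nz rep inj] by blast
  \<comment> \<open>A finite spanning set is independent iff its size is the dimension.\<close>
  also have "\<dots> \<longleftrightarrow> card (?c ` R) = CARD('m)"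
    using basis_card_eq_dim[of "?c ` R" UNIV] card_eq_dim[of "?c ` R" UNIV] span_R
    by auto
  finally show ?thesis
    by (simp add: card_R)
qed

end
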